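(* Let $f,g_1,\ldots,g_m\in\mathbb{R}[\mathbf{x}]$ and $\mathbf{K}=\{\mathbf{x}\in\mathbb{R}^n:g_j(\mathbf{x})\ge0,\ j=1,\ldots,m\}$. Assume that the quadratic module $\mathcal{Q}(g_1,\ldots,g_m)$ is Archimedean and that $f$ is positive on $\mathbf{K}$. Let $\mathcal{A}=\mathrm{supp}(f)\cup\bigcup_{j=1}^m\mathrm{supp}(g_j)$ and let $R$ be the binary matrix whose columns are the sign-symmetries of $\mathcal{A}$. Then $f$ can be represented as $$f=s_0+\sum_{j=1}^m s_jg_j$$ for some sum-of-squares polynomials $s_0,s_1,\ldots,s_m$ satisfying $R^T\alpha\equiv0\pmod2$ for any $\alpha\in\mathrm{supp}(s_j)$, $j=0,\ldots,m$.
   Context: $\mathbb{R}[\mathbf{x}]=\mathbb{R}[x_1,\ldots,x_n]$; $\mathrm{supp}(h)\subseteq\mathbb{N}^n$ is the set of exponents with nonzero coefficient in $h$. A sum-of-squares (SOS) polynomial is a finite sum of squares of polynomials in $\mathbb{R}[\mathbf{x}]$. The quadratic module is $\mathcal{Q}(g_1,\ldots,g_m)=\{s_0+\sum_{j=1}^m s_jg_j: s_j\text{ is SOS},\ j=0,\ldots,m\}$; it is Archimedean if there exists $N>0$ such that $N-\|\mathbf{x}\|^2\in\mathcal{Q}(g_1,\ldots,g_m)$, where $\|\mathbf{x}\|^2=x_1^2+\cdots+x_n^2$. The sign-symmetries of a finite set $\mathcal{A}\subseteq\mathbb{N}^n$ are all vectors $\mathbf{r}\in\{0,1\}^n$ such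 that $\mathbf{r}^T\alpha\equiv0\pmod2$ for all $\alpha\in\mathcal{A}$. *)

theory Defs
  imports "HOL-Analysis.Analysis" "HOL-Library.Poly_Mapping" "HOL-Number_Theory.Cong"
begin

text \<open>Real polynomials in variables indexed by the finite type \<open>'n\<close>: finitely supported maps
  from exponent vectors to coefficients, with the convolution product of \<open>Poly_Mapping\<close>.
  \<open>Poly_Mapping.keys h\<close> is \<open>supp(h)\<close>.\<close>
type_synonym 'n real_mpoly = "(nat^'n) \<Rightarrow>\<^sub>0 real"

definition poly_const :: "real \<Rightarrow> ('n::finite) real_mpoly" where
  "poly_const c = Poly_Mapping.single 0 c"

definition poly_var :: "'n \<Rightarrow> ('n::finite) real_mpoly" where
  "poly_var i = Poly_Mapping.single (axis i 1) 1"

definition poly_eval :: "('n::finite) real_mpoly \<Rightarrow> real^'n \<Rightarrow> real" where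
  "poly_eval p x =
     (\<Sum>\<alpha>\<in>Poly_Mapping.keys p. Poly_Mapping.lookup p \<alpha> * (\<Prod>i\<in>UNIV. (x $ i) ^ (\<alpha> $ i)))"

definition is_sos :: "('n::finite) real_mpoly \<Rightarrow> bool" where
  "is_sos p \<longleftrightarrow> (\<exists>qs :: 'n real_mpoly list. p = (\<Sum>q\<leftarrow>qs. q ^ 2))"

text \<open>A tuple \<open>(g\<^sub>1, \<dots>, g\<^sub>m)\<close> is a function on \<open>nat\<close>, of which only the values
  on \<open>{1..m}\<close> are used.\<close>
definition quadratic_module :: "nat \<Rightarrow> (nat \<Rightarrow> ('n::finite) real_mpoly) \<Rightarrow> 'n real_mpoly set" where
  "quadratic_module m g =
     {s 0 + (\<Sum>j=1..m. s j * g j) | s. \<forall>j\<in>{0..m}. is_sos (s j)}"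

definition archimedean :: "('n::finite) real_mpoly set \<Rightarrow> bool" where
  "archimedean Q \<longleftrightarrow> (\<exists>N>0. poly_const N - (\<Sum>i\<in>UNIV. poly_var i ^ 2) \<in> Q)"

definition nonneg_set :: "nat \<Rightarrow> (nat \<Rightarrow> ('n::finite) real_mpoly) \<Rightarrow> (real^'n) set" where
  "nonneg_set m g = {x. \<forall>j\<in>{1..m}. poly_eval (g j) x \<ge> 0}"

definition sign_symmetries :: "(nat^('n::finite)) set \<Rightarrow> (nat^'n) set" where
  "sign_symmetries A =
     {r. (\<forall>i. r $ i \<in> {0, 1}) \<and> (\<forall>\<alpha>\<in>A. [(\<Sum>i\<in>UNIV. r $ i * \<alpha> $ i) = 0] (mod 2))}"

end

theory Submission
  imports Defs
begin

text \<open>The sign-symmetry condition is added to Putinar's Positivstellensatz. For the latter, if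
  \<open>- 1\<close> is not in the quadratic module \<open>Q - f \<Sigma>\<close>, with \<open>\<Sigma>\<close> the sums of squares, then
  a maximal proper quadratic module containing it yields a point of \<open>K\<close> at which \<open>f \<le> 0\<close>. So
  \<open>p f - 1 \<in> Q\<close> for some sum of squares \<open>p\<close>, and then an algebraic identity lowers a constant \<open>r\<close> with
  \<open>f + r \<in> Q\<close> by a fixed amount until \<open>f \<in> Q\<close>. Finally, the monomials that violate a
  sign symmetry are deleted from the multipliers: this leaves the identity intact because \<open>f\<close> and
  all \<open>g\<^sub>j\<close> are invariant, and it maps \<open>q\<^sup>2\<close> to \<open>q\<^sub>0\<^sup>2 + q\<^sub>1\<^sup>2\<close>, where \<open>q\<^sub>0\<close>
  and \<open>q\<^sub>1\<close> are the invariant and the anti-invariant part of \<open>q\<close>.\<close>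

section \<open>Polynomials and sums of squares\<close>

lemma poly_const_add: "poly_const (a + b) = poly_const a + poly_const b"
  by (simp add: poly_const_def single_add)

lemma poly_const_diff: "poly_const (a - b) = poly_const a - poly_const b"
  by (simp add: poly_const_def single_diff)

lemma poly_const_uminus: "poly_const (- a) = - poly_const a"
  by (simp add: poly_const_def single_uminus)

lemma poly_const_mult: "poly_const (a * b) = poly_const a * poly_const b"
  by (simp add: poly_const_def mult_single)

lemma poly_const_0 [simp]: "poly_const 0 = 0"
  by (simp add: poly_const_def)

lemma poly_const_1 [simp]: "poly_const 1 = 1"
  by (simp add: poly_const_def)

lemma poly_const_numeral [simp]: "poly_const (numeral k) = numeral k"
  by (simp add: poly_const_def)

lemma poly_const_power: "poly_const (a ^ k) = poly_const a ^ k"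
  by (induction k) (simp_all add: poly_const_mult)

lemma poly_const_sum: "poly_const (sum h S) = (\<Sum>x\<in>S. poly_const (h x))"
  by (induction S rule: infinite_finite_induct) (simp_all add: poly_const_add)

lemma poly_const_prod: "poly_const (prod h S) = (\<Prod>x\<in>S. poly_const (h x))"
  by (induction S rule: infinite_finite_induct) (simp_all add: poly_const_mult)

lemma poly_var_power: "poly_var i ^ k = Poly_Mapping.single (axis i k) 1"
proof (induction k)
  case 0
  have "axis i (0::nat) = 0"
    by (simp add: vec_eq_iff axis_def)
  then show ?case
    by (simp only: single_one power_0)
next
  case (Suc k)
  have "axis i 1 + axis i k = axis i (Suc k)"
    by (simp add: vec_eq_iff axis_def)
  with Suc show ?case
    by (simp add: mult_single poly_var_def)
qed

lemma prod_single: "(\<Prod>x\<in>S. Poly_Mapping.single (h x) (c x :: 'b::comm_semiring_1))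
    = Poly_Mapping.single (sum h S) (prod c S)" for h :: "'a \<Rightarrow> 'c::comm_monoid_add"
  by (induction S rule: infinite_finite_induct) (simp_all add: mult_single)

lemma sum_axis: "(\<Sum>i\<in>UNIV. axis i (\<alpha> $ i)) = \<alpha>" for \<alpha> :: "('b::comm_monoid_add)^'n"
  by (simp add: vec_eq_iff axis_def sum.delta)

text \<open>The sum has the shape of \<open>poly_eval\<close>, so replacing each variable by a
  constant turns it into an evaluation.\<close>

lemma poly_monom_expansion:
  "p = (\<Sum>\<alpha>\<in>Poly_Mapping.keys p.
          poly_const (Poly_Mapping.lookup p \<alpha>) * (\<Prod>i\<in>UNIV. poly_var i ^ (\<alpha> $ i)))"
  for p :: "('n::finite) real_mpoly"
proof -
  have monom: "poly_const c * (\<Prod>i\<in>UNIV. poly_var i ^ (\<alpha> $ i)) = Poly_Mapping.single \<alpha> c"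
    for c and \<alpha> :: "nat^'n"
    by (simp add: poly_const_def poly_var_power prod_single sum_axis mult_single)
  show ?thesis
    by (rule poly_mapping_eqI)
      (simp add: monom lookup_sum lookup_single when_def not_in_keys_iff_lookup_eq_zero sum.delta)
qed

text \<open>By the monomial expansion, constants and variables generate the polynomial ring. This
  serves to show that a subring is everything.\<close>

lemma real_mpoly_induct [case_names const var add mult]:
  fixes p :: "('n::finite) real_mpoly"
  assumes const: "\<And>c. P (poly_const c)"
    and var: "\<And>i. P (poly_var i)"
    and add: "\<And>p q. P p \<Longrightarrow> P q \<Longrightarrow> P (p + q)"
    and mult: "\<And>p q. P p \<Longrightarrow> P q \<Longrightarrow> P (p * q)"
  shows "P p"
proof -
  have 0: "P 0" and 1: "P 1"
    using const[of 0] const[of 1] by simp_all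
  have power: "P (poly_var i ^ k)" for i k
    by (induction k) (auto intro: 1 mult var)
  have prod: "P (\<Prod>i\<in>S. poly_var i ^ \<alpha> i)" for S \<alpha>
    by (induction S rule: infinite_finite_induct) (auto intro: 1 mult power)
  have "P (\<Sum>\<alpha>\<in>S. poly_const (c \<alpha>) * (\<Prod>i\<in>UNIV. poly_var i ^ (\<alpha> $ i)))" for S c
    by (induction S rule: infinite_finite_induct) (auto intro: 0 add mult const prod)
  then show ?thesis
    by (subst poly_monom_expansion[of p])
qed

lemma is_sos_0: "is_sos 0"
  unfolding is_sos_def by (rule exI[of _ "[]"]) simp

lemma is_sos_square: "is_sos (a ^ 2)"
  unfolding is_sos_def by (rule exI[of _ "[a]"]) simp

lemma is_sos_1: "is_sos 1"
  using is_sos_square[of 1] by simp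

lemma is_sos_add:
  assumes "is_sos a" "is_sos b"
  shows "is_sos (a + b)"
proof -
  obtain xs ys where "a = (\<Sum>q\<leftarrow>xs. q ^ 2)" "b = (\<Sum>q\<leftarrow>ys. q ^ 2)"
    using assms unfolding is_sos_def by blast
  then have "a + b = (\<Sum>q\<leftarrow>xs @ ys. q ^ 2)"
    by simp
  then show ?thesis
    unfolding is_sos_def by blast
qed

lemma is_sos_induct [consumes 1, case_names zero add_square]:
  assumes "is_sos s" "P 0" "\<And>a s. is_sos s \<Longrightarrow> P s \<Longrightarrow> P (a ^ 2 + s)"
  shows "P s"
proof -
  obtain qs where qs: "s = (\<Sum>q\<leftarrow>qs. q ^ 2)"
    using assms(1) unfolding is_sos_def by blast
  have "P (\<Sum>q\<leftarrow>qs. q ^ 2)"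
  proof (induction qs)
    case (Cons a qs)
    have "is_sos (\<Sum>q\<leftarrow>qs. q ^ 2)"
      unfolding is_sos_def by blast
    with Cons assms(3) show ?case
      by simp
  qed (simp add: assms(2))
  with qs show ?thesis
    by simp
qed

lemma is_sos_square_mult: "is_sos s \<Longrightarrow> is_sos (a ^ 2 * s)"
  by (induction s rule: is_sos_induct)
    (simp_all add: is_sos_0 is_sos_add is_sos_square distrib_left flip: power_mult_distrib)

section \<open>Quadratic modules\<close>

locale qmodule =
  fixes Q :: "('n::finite) real_mpoly set"
  assumes one_mem: "1 \<in> Q"
    and add_mem: "a \<in> Q \<Longrightarrow> b \<in> Q \<Longrightarrow> a + b \<in> Q"
    and square_mult_mem: "a \<in> Q \<Longrightarrow> b ^ 2 * a \<in> Q"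
begin

lemma zero_mem: "0 \<in> Q"
  using square_mult_mem[OF one_mem, of 0] by simp

lemma sos_mult_mem: "is_sos s \<Longrightarrow> a \<in> Q \<Longrightarrow> s * a \<in> Q"
  by (induction s rule: is_sos_induct) (simp_all add: zero_mem add_mem square_mult_mem distrib_right)

lemma sos_mem: "is_sos s \<Longrightarrow> s \<in> Q"
  using sos_mult_mem[OF _ one_mem] by simp

lemma square_mem: "a ^ 2 \<in> Q"
  by (rule sos_mem[OF is_sos_square])

text \<open>A nonnegative constant is the square of the constant \<open>sqrt c\<close>.\<close>

lemma const_mult_mem: "c \<ge> 0 \<Longrightarrow> a \<in> Q \<Longrightarrow> poly_const c * a \<in> Q"
  using square_mult_mem[of a "poly_const (sqrt c)"] by (simp flip: poly_const_power)

lemma const_mem: "c \<ge> 0 \<Longrightarrow> poly_const c \<in> Q"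
  using const_mult_mem[OF _ one_mem] by simp

lemma mem_of_const_mult_mem:
  assumes "c > 0" "poly_const c * a \<in> Q"
  shows "a \<in> Q"
  using const_mult_mem[OF _ assms(2), of "1 / c"] assms(1)
  by (simp flip: mult.assoc poly_const_mult)

text \<open>A negative constant could be rescaled by a positive one to -1.\<close>

lemma const_nonneg:
  assumes "-1 \<notin> Q" "poly_const c \<in> Q"
  shows "c \<ge> 0"
proof (rule ccontr)
  assume "\<not> c \<ge> 0"
  then have "poly_const (1 / - c) * poly_const c \<in> Q"
    by (intro const_mult_mem assms(2)) simp
  moreover have "poly_const (1 / - c) * poly_const c = -1"
    using \<open>\<not> c \<ge> 0\<close> by (simp add: poly_const_uminus flip: poly_const_mult)
  ultimately show False
    using assms(1) by metis
qed

text \<open>The support \<open>Q\<close> \<inter> \<open>- Q\<close> is an ideal, because 4 b = (b +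
  1)^2 - (b - 1)^2 and positive constants can be divided out.\<close>

lemma support_mult:
  assumes "a \<in> Q" "- a \<in> Q"
  shows "b * a \<in> Q"
proof -
  have "(b + 1) ^ 2 * a + (b - 1) ^ 2 * (- a) \<in> Q"
    by (intro add_mem square_mult_mem assms)
  also have "(b + 1) ^ 2 * a + (b - 1) ^ 2 * (- a) = poly_const 4 * (b * a)"
    by (simp add: algebra_simps power2_eq_square)
  finally show ?thesis
    by (rule mem_of_const_mult_mem[rotated]) simp
qed

end

text \<open>For a quadratic module \<open>Q\<close>, this is the quadratic module generated by
  \<open>Q\<close> and \<open>a\<close>.\<close>

definition adjoin :: "('n::finite) real_mpoly set \<Rightarrow> 'n real_mpoly \<Rightarrow> 'n real_mpoly set" where
  "adjoin Q a = {q + s * a | q s. q \<in> Q \<and> is_sos s}"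

lemma (in qmodule) qmodule_adjoin: "qmodule (adjoin Q a)"
proof
  show "1 \<in> adjoin Q a"
    using one_mem is_sos_0 unfolding adjoin_def by force
next
  fix x y assume "x \<in> adjoin Q a" "y \<in> adjoin Q a"
  then obtain q s q' s' where "x = q + s * a" "y = q' + s' * a"
    and *: "q \<in> Q" "q' \<in> Q" "is_sos s" "is_sos s'"
    unfolding adjoin_def by blast
  then have "x + y = (q + q') + (s + s') * a"
    by (simp add: algebra_simps)
  with * show "x + y \<in> adjoin Q a"
    unfolding adjoin_def using add_mem is_sos_add by blast
next
  fix x b assume "x \<in> adjoin Q a"
  then obtain q s where "x = q + s * a" and *: "q \<in> Q" "is_sos s"
    unfolding adjoin_def by blast
  then have "b ^ 2 * x = b ^ 2 * q + (b ^ 2 * s) * a"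
    by (simp add: algebra_simps)
  with * show "b ^ 2 * x \<in> adjoin Q a"
    unfolding adjoin_def using square_mult_mem is_sos_square_mult by blast
qed

lemma subset_adjoin: "Q \<subseteq> adjoin Q a"
  unfolding adjoin_def using is_sos_0 by force

lemma (in qmodule) mem_adjoin: "a \<in> adjoin Q a"
  unfolding adjoin_def using zero_mem is_sos_square[of 1] by force

text \<open>The Archimedean property in its strong form: every polynomial, not just the squared
  norm, is bounded above modulo \<open>Q\<close>.\<close>

locale arch_qmodule = qmodule Q for Q :: "('n::finite) real_mpoly set" +
  assumes arch: "\<exists>c. poly_const c - a \<in> Q"
begin

lemma arch_ge: obtains c where "c \<ge> d" "poly_const c - a \<in> Q"
proof -
  obtain c where c: "poly_const c - a \<in> Q"
    using arch by blast
  have "(poly_const c - a) + poly_const (max c d - c) \<in> Q"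
    by (intro add_mem c const_mem) simp
  then show thesis
    using that[of "max c d"] by (simp add: poly_const_diff)
qed

lemma mem_of_sos_mult_diff_one_mem:
  assumes p: "is_sos p" and pf: "p * f - 1 \<in> Q"
  shows "f \<in> Q"
proof (rule ccontr)
  assume f: "f \<notin> Q"
  obtain c where c: "c \<ge> 2" "poly_const c - p \<in> Q"
    by (rule arch_ge)
  obtain d where d: "d \<ge> c" "poly_const d - (1 + p ^ 2 * f) \<in> Q"
    by (rule arch_ge)
  \<comment> \<open>The constant 2 k bounds both \<open>p\<close> and \<open>1 + p ^ 2 * f\<close>
    modulo \<open>Q\<close>. It is chosen before \<open>r\<close>, so every step lowers
    \<open>r\<close> by the same amount.\<close>
  define k where "k = d / 2"
  define K :: "'n real_mpoly" where "K = poly_const k"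
  have k: "k > 0"
    using c(1) d(1) by (simp add: k_def)
  have twoK: "poly_const d = 2 * K"
    using poly_const_mult[of 2 k] by (simp add: k_def K_def)
  have "(poly_const c - p) + poly_const (d - c) \<in> Q"
    using c d by (intro add_mem const_mem) auto
  then have Kp: "2 * K - p \<in> Q"
    by (simp add: poly_const_diff twoK)
  have K1: "2 * K - (1 + p ^ 2 * f) \<in> Q"
    using d(2) by (simp add: twoK)
  have step: "f + poly_const (r - 1 / k ^ 2) \<in> Q" if r: "r \<ge> 0" "f + poly_const r \<in> Q" for r
  proof -
    let ?r = "poly_const r"
    \<comment> \<open>In (K - p)^2 f the terms -2 K p f and p^2 f are cancelled by the second and
      third summands, which leave -1. The last summand completes r (K - p)^2 to r K^2.\<close>
    have "(K - p) ^ 2 * (f + ?r) + poly_const d * (p * f - 1) + (2 * K - (1 + p ^ 2 * f))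
        + ?r * (p * (2 * K - p)) \<in> Q"
      using c d by (intro add_mem square_mult_mem const_mult_mem sos_mult_mem p r pf Kp K1) auto
    also have "(K - p) ^ 2 * (f + ?r) + poly_const d * (p * f - 1) + (2 * K - (1 + p ^ 2 * f))
        + ?r * (p * (2 * K - p)) = K ^ 2 * (f + ?r) - 1"
      unfolding twoK by (simp add: algebra_simps power2_eq_square)
    also have "\<dots> = poly_const (k ^ 2) * (f + poly_const (r - 1 / k ^ 2))"
    proof -
      have "(poly_const (k ^ 2) :: 'n real_mpoly) * poly_const (1 / k ^ 2) = 1"
        using k by (simp flip: poly_const_mult)
      then show ?thesis
        by (simp add: K_def poly_const_diff algebra_simps flip: poly_const_power)
    qed
    finally show ?thesis
      by (rule mem_of_const_mult_mem[rotated]) (use k in simp)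
  qed
  have neg: "f \<in> Q" if "f + poly_const r \<in> Q" "r \<le> 0" for r
    using add_mem[OF that(1) const_mem[of "- r"]] that(2) by (simp add: poly_const_uminus)
  obtain r where r: "poly_const r - (- f) \<in> Q"
    using arch by blast
  \<comment> \<open>Because \<open>f\<close> is not in \<open>Q\<close>, \<open>neg\<close> keeps
    the remaining constant positive, so the lowering step applies indefinitely. The Archimedean
    property of the reals then gives the contradiction.\<close>
  have all: "f + poly_const (r - real i / k ^ 2) \<in> Q" for i
  proof (induction i)
    case 0
    then show ?case
      using r by (simp add: add.commute)
  next
    case (Suc i)
    have "r - real i / k ^ 2 \<ge> 0"
      using neg[OF Suc.IH] f by force
    from step[OF this Suc.IH] show ?case
      by (simp add: diff_diff_eq add_divide_distrib add.commute)
  qed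
  obtain i where "r * k ^ 2 < real i"
    using reals_Archimedean2 by blast
  then have "r - real i / k ^ 2 \<le> 0"
    using k by (simp add: field_simps)
  with all[of i] neg f show False
    by blast
qed

end

section \<open>Maximal proper quadratic modules\<close>

locale maximal_qmodule = arch_qmodule Q for Q :: "('n::finite) real_mpoly set" +
  assumes proper: "-1 \<notin> Q"
    and maximal: "qmodule X \<Longrightarrow> -1 \<notin> X \<Longrightarrow> Q \<subseteq> X \<Longrightarrow> X = Q"
begin

text \<open>Otherwise maximality would make \<open>adjoin Q a\<close>, which contains
  \<open>a\<close>, equal to \<open>Q\<close>.\<close>

lemma minus_one_mem_adjoin:
  assumes "a \<notin> Q"
  shows "-1 \<in> adjoin Q a"
  using maximal[OF qmodule_adjoin _ subset_adjoin] mem_adjoin assms by blast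

lemma total: "a \<in> Q \<or> - a \<in> Q"
proof (rule ccontr)
  assume "\<not> (a \<in> Q \<or> - a \<in> Q)"
  then have "-1 \<in> adjoin Q a" "-1 \<in> adjoin Q (- a)"
    using minus_one_mem_adjoin by auto
  then obtain q s r t where 1: "-1 = q + s * a" and 2: "-1 = r + t * (- a)"
    and mem: "q \<in> Q" "r \<in> Q" "is_sos s" "is_sos t"
    unfolding adjoin_def by blast
  \<comment> \<open>Eliminating \<open>a\<close> from the two representations gives t (1 + q) + s (1
    + r) = 0, so this element of \<open>Q\<close> equals \<open>- s\<close>. Thus \<open>s\<close>
    lies in the support, so \<open>s * a\<close> is in \<open>Q\<close>, and with it
    \<open>q + s * a\<close>, which is -1.\<close>
  have "t + t * q + s * r \<in> Q"
    by (intro add_mem sos_mult_mem sos_mem mem)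
  also have "t + t * q + s * r = t * (1 + q) + s * (1 + r) - s"
    by (simp add: algebra_simps)
  also have "\<dots> = - s"
  proof -
    have "1 + q = - (s * a)" "1 + r = t * a"
      using 1 2 by (simp_all add: algebra_simps add_eq_0_iff eq_neg_iff_add_eq_0)
    then show ?thesis
      by (simp add: algebra_simps)
  qed
  finally have "a * s \<in> Q"
    by (intro support_mult[OF sos_mem[OF mem(3)]])
  then have "q + s * a \<in> Q"
    using add_mem mem by (simp add: mult.commute)
  with 1 proper show False
    by simp
qed

text \<open>The set of all \<open>a\<close> with \<open>a + \<epsilon> \<in> Q\<close> for every \<open>\<epsilon> > 0\<close> is again a proper quadratic
  module, because squares are bounded modulo \<open>Q\<close>.\<close>
lemma closed:
  assumes "\<And>e. e > 0 \<Longrightarrow> a + poly_const e \<in> Q"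
  shows "a \<in> Q"
proof -
  define X where "X = {a. \<forall>e>0. a + poly_const e \<in> Q}"
  have "qmodule X"
  proof
    show "1 \<in> X"
      unfolding X_def by (auto intro!: add_mem one_mem const_mem)
  next
    fix a b assume ab: "a \<in> X" "b \<in> X"
    have "a + b + poly_const e \<in> Q" if "e > 0" for e
    proof -
      have "(a + poly_const (e / 2)) + (b + poly_const (e / 2)) \<in> Q"
        using ab that by (intro add_mem[of "a + _" "b + _"]) (auto simp: X_def)
      also have "(a + poly_const (e / 2)) + (b + poly_const (e / 2))
          = a + b + (poly_const (e / 2) + poly_const (e / 2))"
        by (simp only: ac_simps)
      also have "\<dots> = a + b + poly_const e"
        by (simp flip: poly_const_add)
      finally show ?thesis .
    qed
    then show "a + b \<in> X"
      by (simp add: X_def)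
  next
    fix a b assume a: "a \<in> X"
    have "b ^ 2 * a + poly_const e \<in> Q" if e: "e > 0" for e
    proof -
      obtain c where c: "c \<ge> 1" "poly_const c - b ^ 2 \<in> Q"
        by (rule arch_ge)
      have "b ^ 2 * (a + poly_const (e / c)) + poly_const (e / c) * (poly_const c - b ^ 2) \<in> Q"
        using a c e by (intro add_mem[OF square_mult_mem const_mult_mem]) (auto simp: X_def)
      moreover have "(poly_const e :: 'n real_mpoly) = poly_const (e / c) * poly_const c"
        using c by (simp flip: poly_const_mult)
      ultimately show ?thesis
        by (simp add: distrib_left right_diff_distrib mult.commute)
    qed
    then show "b ^ 2 * a \<in> X"
      by (simp add: X_def)
  qed
  moreover have "-1 \<notin> X"
  proof
    assume "-1 \<in> X"
    then have "- 1 + poly_const (1 / 2) \<in> Q"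
      by (simp add: X_def)
    also have "- 1 + poly_const (1 / 2) = poly_const (- 1 + 1 / 2)"
      by (simp only: poly_const_add poly_const_uminus poly_const_1)
    finally show False
      using const_nonneg[OF proper] by force
  qed
  moreover have "Q \<subseteq> X"
    unfolding X_def by (auto intro!: add_mem const_mem)
  ultimately have "X = Q"
    by (rule maximal)
  then show ?thesis
    using assms by (auto simp: X_def)
qed

section \<open>Congruence modulo the support of a maximal quadratic module\<close>

definition congr :: "'n real_mpoly \<Rightarrow> 'n real_mpoly \<Rightarrow> bool" where
  "congr a b \<longleftrightarrow> a - b \<in> Q \<and> b - a \<in> Q"

lemma congr_refl: "congr a a"
  by (simp add: congr_def zero_mem)

lemma congr_add: "congr a b \<Longrightarrow> congr c d \<Longrightarrow> congr (a + c) (b + d)"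
  unfolding congr_def by (metis add_mem add_diff_add)

text \<open>Compatibility with products holds because the support is an ideal
  (\<open>support_mult\<close>).\<close>

lemma congr_mult:
  assumes "congr a b" "congr c d"
  shows "congr (a * c) (b * d)"
proof -
  have "a * (c - d) + d * (a - b) \<in> Q" "a * (d - c) + d * (b - a) \<in> Q"
    using assms by (auto simp: congr_def intro!: add_mem support_mult)
  then show ?thesis
    by (simp add: congr_def algebra_simps)
qed

lemma congr_power: "congr a b \<Longrightarrow> congr (a ^ k) (b ^ k)"
  by (induction k) (auto intro: congr_refl congr_mult)

lemma congr_prod: "(\<And>x. x \<in> S \<Longrightarrow> congr (a x) (b x)) \<Longrightarrow> congr (prod a S) (prod b S)"
  by (induction S rule: infinite_finite_induct) (auto intro: congr_refl congr_mult)

lemma congr_sum: "(\<And>x. x \<in> S \<Longrightarrow> congr (a x) (b x)) \<Longrightarrow> congr (sum a S) (sum b S)"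
  by (induction S rule: infinite_finite_induct) (auto intro: congr_refl congr_add)

text \<open>The residue of \<open>a\<close> is the infimum of its upper bounds modulo
  \<open>Q\<close>. It exists because \<open>Q\<close> is proper and Archimedean; closedness puts
  \<open>poly_const r - a\<close> in \<open>Q\<close>, and totality together with closedness gives
  the opposite difference.\<close>

lemma congr_const: "\<exists>r. congr a (poly_const r)"
proof -
  define R where "R = {r. poly_const r - a \<in> Q}"
  obtain c where c: "poly_const c - (- a) \<in> Q"
    using arch by blast
  have lower: "- c \<le> r" if "r \<in> R" for r
  proof -
    have "(poly_const r - a) + (poly_const c - (- a)) \<in> Q"
      using that c by (intro add_mem) (auto simp: R_def)
    then have "poly_const (r + c) \<in> Q"
      by (simp add: poly_const_add)
    from const_nonneg[OF proper this] show ?thesis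
      by simp
  qed
  have bdd: "bdd_below R"
    using lower by (intro bdd_belowI)
  have ne: "R \<noteq> {}"
    using arch by (auto simp: R_def)
  define r where "r = Inf R"
  have "poly_const r - a \<in> Q"
  proof (rule closed)
    fix e :: real assume "e > 0"
    then obtain s where s: "s \<in> R" "s < r + e"
      using cInf_lessD[OF ne, of "r + e"] by (auto simp: r_def)
    have "(poly_const s - a) + poly_const (r + e - s) \<in> Q"
      using s by (intro add_mem const_mem) (auto simp: R_def)
    then show "poly_const r - a + poly_const e \<in> Q"
      by (simp add: poly_const_add poly_const_diff algebra_simps)
  qed
  moreover have "a - poly_const r \<in> Q"
  proof (rule closed)
    fix e :: real assume "e > 0"
    \<comment> \<open>A number below the infimum is not an upper bound, so by totality the negated
      difference lies in \<open>Q\<close>.\<close>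
    then have "r - e \<notin> R"
      using cInf_lower[OF _ bdd, of "r - e"] by (auto simp: r_def)
    then have "- (poly_const (r - e) - a) \<in> Q"
      using total[of "poly_const (r - e) - a"] by (simp add: R_def)
    then show "a - poly_const r + poly_const e \<in> Q"
      by (simp add: poly_const_diff algebra_simps)
  qed
  ultimately show ?thesis
    by (auto simp: congr_def)
qed

text \<open>The coordinates of the point are the residues of the variables. Every polynomial is then
  congruent to its value there, and a constant in a proper quadratic module is nonnegative.\<close>

lemma exists_point: "\<exists>x. \<forall>p\<in>Q. poly_eval p x \<ge> 0"
proof -
  obtain x where x: "congr (poly_var i) (poly_const (x i))" for i
    using choice[of "\<lambda>i r. congr (poly_var i) (poly_const r)"] congr_const by blast
  let ?x = "\<chi> i. x i"
  have "congr p (poly_const (poly_eval p ?x))" for p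
  proof -
    have "congr (\<Sum>\<alpha>\<in>Poly_Mapping.keys p.
            poly_const (Poly_Mapping.lookup p \<alpha>) * (\<Prod>i\<in>UNIV. poly_var i ^ (\<alpha> $ i)))
          (\<Sum>\<alpha>\<in>Poly_Mapping.keys p.
            poly_const (Poly_Mapping.lookup p \<alpha>) * (\<Prod>i\<in>UNIV. poly_const (x i) ^ (\<alpha> $ i)))"
      by (intro congr_sum congr_mult congr_refl congr_prod congr_power x)
    also have "(\<Sum>\<alpha>\<in>Poly_Mapping.keys p.
            poly_const (Poly_Mapping.lookup p \<alpha>) * (\<Prod>i\<in>UNIV. poly_const (x i) ^ (\<alpha> $ i)))
        = poly_const (poly_eval p ?x)"
      by (simp add: poly_eval_def poly_const_sum poly_const_mult poly_const_prod poly_const_power)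
    finally show ?thesis
      by (simp flip: poly_monom_expansion)
  qed
  then have "poly_const (poly_eval p ?x) - p \<in> Q" for p
    by (simp add: congr_def)
  then have "poly_const (poly_eval p ?x) \<in> Q" if "p \<in> Q" for p
    using add_mem[OF _ that] by (metis diff_add_cancel)
  then show ?thesis
    using const_nonneg[OF proper] by blast
qed

end

section \<open>Extension to a maximal quadratic module and the Positivstellensatz\<close>

lemma (in arch_qmodule) exists_maximal:
  assumes "-1 \<notin> Q"
  obtains X where "Q \<subseteq> X" "maximal_qmodule X"
proof -
  define F where "F = {X. qmodule X \<and> Q \<subseteq> X \<and> -1 \<notin> X}"
  have "Q \<in> F"
    unfolding F_def using assms qmodule_axioms by blast
  moreover have "\<Union>C \<in> F" if C: "C \<noteq> {}" "subset.chain F C" for C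
  proof -
    have CF: "\<And>X. X \<in> C \<Longrightarrow> qmodule X \<and> Q \<subseteq> X \<and> -1 \<notin> X"
      using C(2) by (auto simp: subset_chain_def F_def)
    have "qmodule (\<Union>C)"
    proof
      show "1 \<in> \<Union>C"
        using C(1) CF qmodule.one_mem by blast
    next
      fix a b assume "a \<in> \<Union>C" "b \<in> \<Union>C"
      \<comment> \<open>Two members of a chain are comparable, so the larger one contains both
        \<open>a\<close> and \<open>b\<close>.\<close>
      then obtain X where "X \<in> C" "a \<in> X" "b \<in> X"
        using C(2) unfolding subset_chain_def by blast
      then show "a + b \<in> \<Union>C"
        using CF qmodule.add_mem by blast
    next
      fix a b assume "a \<in> \<Union>C"
      then show "b ^ 2 * a \<in> \<Union>C"
        using CF qmodule.square_mult_mem by blast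
    qed
    then show ?thesis
      unfolding F_def using C(1) CF by blast
  qed
  ultimately obtain X where X: "X \<in> F" and max: "\<And>Y. Y \<in> F \<Longrightarrow> X \<subseteq> Y \<Longrightarrow> Y = X"
    using subset_Zorn_nonempty[of F] by blast
  interpret X: qmodule X
    using X by (simp add: F_def)
  have "maximal_qmodule X"
  proof
    show "\<exists>c. poly_const c - a \<in> X" for a
      using arch[of a] X by (auto simp: F_def)
    show "-1 \<notin> X"
      using X by (simp add: F_def)
    show "Y = X" if "qmodule Y" "-1 \<notin> Y" "X \<subseteq> Y" for Y
      using max[of Y] X that by (auto simp: F_def)
  qed
  then show thesis
    using that X by (auto simp: F_def)
qed

lemma poly_eval_uminus: "poly_eval (- p) x = - poly_eval p x"
  by (simp add: poly_eval_def sum_negf)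

text \<open>If -1 lies in \<open>adjoin Q (- f)\<close>, its representation is a certificate
  \<open>s * f - 1\<close> in \<open>Q\<close>, to which \<open>mem_of_sos_mult_diff_one_mem\<close>
  applies. Otherwise a maximal extension yields a point at which \<open>Q\<close> is nonnegative and
  \<open>f\<close> is not positive.\<close>

theorem (in arch_qmodule) positivstellensatz:
  assumes pos: "\<And>x. (\<And>p. p \<in> Q \<Longrightarrow> poly_eval p x \<ge> 0) \<Longrightarrow> poly_eval f x > 0"
  shows "f \<in> Q"
proof (cases "-1 \<in> adjoin Q (- f)")
  case True
  then obtain q s where "-1 = q + s * (- f)" and qs: "q \<in> Q" "is_sos s"
    unfolding adjoin_def by blast
  then have "s * f - 1 = q"
    by (simp add: algebra_simps)
  with qs show ?thesis
    using mem_of_sos_mult_diff_one_mem by blast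
next
  case False
  interpret A: qmodule "adjoin Q (- f)"
    by (rule qmodule_adjoin)
  interpret A: arch_qmodule "adjoin Q (- f)"
    by unfold_locales (use arch subset_adjoin in blast)
  obtain X where X: "adjoin Q (- f) \<subseteq> X" "maximal_qmodule X"
    using A.exists_maximal[OF False] .
  obtain x where x: "\<forall>p\<in>X. poly_eval p x \<ge> 0"
    using maximal_qmodule.exists_point[OF X(2)] by blast
  have "poly_eval (- f) x \<ge> 0"
    using x X(1) mem_adjoin by blast
  moreover have "poly_eval f x > 0"
    using pos x X(1) subset_adjoin by blast
  ultimately show ?thesis
    by (simp add: poly_eval_uminus)
qed

section \<open>Finitely generated Archimedean quadratic modules\<close>

lemma qmodule_quadratic_module: "qmodule (quadratic_module m g)"
proof
  show "1 \<in> quadratic_module m g"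
    unfolding quadratic_module_def
    by (intro CollectI exI[of _ "\<lambda>j. if j = 0 then 1 else 0"]) (auto simp: is_sos_0 is_sos_1)
next
  fix a b assume "a \<in> quadratic_module m g" "b \<in> quadratic_module m g"
  then obtain s t where "a = s 0 + (\<Sum>j=1..m. s j * g j)" "b = t 0 + (\<Sum>j=1..m. t j * g j)"
    and *: "\<forall>j\<in>{0..m}. is_sos (s j)" "\<forall>j\<in>{0..m}. is_sos (t j)"
    unfolding quadratic_module_def by blast
  then have "a + b = (s 0 + t 0) + (\<Sum>j=1..m. (s j + t j) * g j)"
    by (simp add: algebra_simps sum.distrib)
  with * show "a + b \<in> quadratic_module m g"
    unfolding quadratic_module_def
    by (intro CollectI exI[of _ "\<lambda>j. s j + t j"]) (auto intro: is_sos_add)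
next
  fix a b assume "a \<in> quadratic_module m g"
  then obtain s where "a = s 0 + (\<Sum>j=1..m. s j * g j)" and *: "\<forall>j\<in>{0..m}. is_sos (s j)"
    unfolding quadratic_module_def by blast
  then have "b ^ 2 * a = b ^ 2 * s 0 + (\<Sum>j=1..m. (b ^ 2 * s j) * g j)"
    by (simp add: distrib_left sum_distrib_left mult.assoc)
  with * show "b ^ 2 * a \<in> quadratic_module m g"
    unfolding quadratic_module_def
    by (intro CollectI exI[of _ "\<lambda>j. b ^ 2 * s j"]) (auto intro: is_sos_square_mult)
qed

lemma generator_mem_quadratic_module:
  assumes "j \<in> {1..m}"
  shows "g j \<in> quadratic_module m g"
proof -
  let ?s = "\<lambda>i. if i = j then 1 else 0"
  have "(\<Sum>i=1..m. ?s i * g i) = (\<Sum>i=1..m. if i = j then g i else 0)"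
    by (intro sum.cong) auto
  also have "\<dots> = g j"
    using assms by (simp add: sum.delta)
  \<comment> \<open>Since \<open>j\<close> is at least 1, the multiplier \<open>?s 0\<close>
    vanishes.\<close>
  finally have "g j = ?s 0 + (\<Sum>i=1..m. ?s i * g i)"
    using assms by simp
  moreover have "\<forall>i\<in>{0..m}. is_sos (?s i)"
    by (simp add: is_sos_0 is_sos_1)
  ultimately show ?thesis
    unfolding quadratic_module_def by (intro CollectI exI[of _ ?s] conjI)
qed

text \<open>The polynomials bounded on both sides by constants modulo \<open>Q\<close> form a ring
  that contains the constants and, thanks to the bound on the squared norm, the variables.\<close>

lemma (in qmodule) arch_qmoduleI:
  assumes "archimedean Q"
  shows "arch_qmodule Q"
proof
  fix a :: "'n real_mpoly"
  define P where "P = (\<lambda>a. \<exists>c. poly_const c - a \<in> Q \<and> poly_const c + a \<in> Q)"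
  have scale: "P (poly_const d * a)" if "P a" "d \<ge> 0" for a d
  proof -
    obtain c where "poly_const c - a \<in> Q" "poly_const c + a \<in> Q"
      using \<open>P a\<close> by (auto simp: P_def)
    then have "poly_const d * (poly_const c - a) \<in> Q" "poly_const d * (poly_const c + a) \<in> Q"
      using \<open>d \<ge> 0\<close> by (auto intro: const_mult_mem)
    then show ?thesis
      unfolding P_def by (intro exI[of _ "d * c"]) (simp add: poly_const_mult algebra_simps)
  qed
  have uminus: "P (- a)" if "P a" for a
    using that by (auto simp: P_def)
  have add: "P (a + b)" if ab: "P a" "P b" for a b
  proof -
    obtain c d where "poly_const c - a \<in> Q" "poly_const c + a \<in> Q"
      "poly_const d - b \<in> Q" "poly_const d + b \<in> Q"
      using ab by (auto simp: P_def)
    then have "(poly_const c - a) + (poly_const d - b) \<in> Q"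
      "(poly_const c + a) + (poly_const d + b) \<in> Q"
      by (auto intro: add_mem)
    then show ?thesis
      unfolding P_def by (intro exI[of _ "c + d"]) (simp add: poly_const_add algebra_simps)
  qed
  have square: "P (a ^ 2)" if a: "P a" for a
  proof -
    obtain c0 where c0: "poly_const c0 - a \<in> Q" "poly_const c0 + a \<in> Q"
      using a by (auto simp: P_def)
    \<comment> \<open>Enlarging the bound to at least 1 allows division by 2 c below.\<close>
    define c where "c = max c0 1"
    let ?c = "poly_const c"
    have "(poly_const c0 - a) + poly_const (c - c0) \<in> Q" "(poly_const c0 + a) + poly_const (c - c0) \<in> Q"
      using c0 by (auto intro!: add_mem const_mem simp: c_def)
    then have ca: "?c - a \<in> Q" "?c + a \<in> Q"
      by (simp_all add: poly_const_diff add.commute)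
    \<comment> \<open>Factoring out (c + a)(c - a) leaves (c - a) + (c + a) = 2 c.\<close>
    have "(?c + a) ^ 2 * (?c - a) + (?c - a) ^ 2 * (?c + a) \<in> Q"
      by (intro add_mem square_mult_mem ca)
    also have "(?c + a) ^ 2 * (?c - a) + (?c - a) ^ 2 * (?c + a) = poly_const (2 * c) * (?c ^ 2 - a ^ 2)"
      unfolding poly_const_mult by (simp add: algebra_simps power2_eq_square)
    finally have "?c ^ 2 - a ^ 2 \<in> Q"
      by (rule mem_of_const_mult_mem[rotated]) (simp add: c_def)
    moreover have "?c ^ 2 + a ^ 2 \<in> Q"
      by (intro add_mem square_mem)
    ultimately show ?thesis
      unfolding P_def by (intro exI[of _ "c ^ 2"]) (simp add: poly_const_power)
  qed
  have "P a"
  proof (induction a rule: real_mpoly_induct)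
    case (const c)
    have "poly_const \<bar>c\<bar> - poly_const c \<in> Q" "poly_const \<bar>c\<bar> + poly_const c \<in> Q"
      unfolding poly_const_add[symmetric] poly_const_diff[symmetric] by (auto intro: const_mem)
    then show ?case
      by (auto simp: P_def)
  next
    case (var i)
    let ?x = "poly_var :: 'n \<Rightarrow> 'n real_mpoly" and ?h = "poly_const (1 / 2) :: 'n real_mpoly"
    obtain N where N: "poly_const N - (\<Sum>i\<in>UNIV. ?x i ^ 2) \<in> Q"
      using assms by (auto simp: archimedean_def)
    \<comment> \<open>Adding back the squares of the other variables isolates the bound on a single
      square.\<close>
    have "(\<Sum>j\<in>S. ?x j ^ 2) \<in> Q" for S
      by (induction S rule: infinite_finite_induct) (auto intro: zero_mem add_mem square_mem)
    from add_mem[OF N this[of "UNIV - {i}"]] have Ni: "poly_const N - ?x i ^ 2 \<in> Q"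
      by (simp add: sum.remove[of UNIV i])
    have h: "?h ^ 2 = poly_const (1 / 4)"
      by (simp add: power_divide flip: poly_const_power)
    have "2 * ?h = 1"
      unfolding poly_const_numeral[symmetric] poly_const_mult[symmetric] by simp
    then have hx: "2 * (?h * ?x i) = ?x i"
      by (simp flip: mult.assoc)
    \<comment> \<open>Completing the square turns the bound N on x^2 into the bound N + 1/4 on both
      x and -x.\<close>
    have "(?x i - ?h) ^ 2 = ?x i ^ 2 - 2 * (?h * ?x i) + ?h ^ 2"
      "(?x i + ?h) ^ 2 = ?x i ^ 2 + 2 * (?h * ?x i) + ?h ^ 2"
      by (simp_all add: power2_eq_square algebra_simps)
    then have sq: "(?x i - ?h) ^ 2 = ?x i ^ 2 - ?x i + poly_const (1 / 4)"
      "(?x i + ?h) ^ 2 = ?x i ^ 2 + ?x i + poly_const (1 / 4)"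
      by (simp_all only: h hx)
    have "(poly_const N - ?x i ^ 2) + (?x i - ?h) ^ 2 \<in> Q"
      "(poly_const N - ?x i ^ 2) + (?x i + ?h) ^ 2 \<in> Q"
      by (intro add_mem square_mem Ni)+
    then show ?case
      unfolding P_def by (intro exI[of _ "N + 1 / 4"]) (simp add: sq poly_const_add algebra_simps)
  next
    case (add p q)
    then show ?case
      by (rule \<open>\<And>a b. P a \<Longrightarrow> P b \<Longrightarrow> P (a + b)\<close>)
  next
    case (mult p q)
    \<comment> \<open>Polarization reduces products to squares: 4 p q = (p + q)^2 - (p -
      q)^2.\<close>
    have "P (poly_const (1 / 4) * ((p + q) ^ 2 + - ((p + - q) ^ 2)))"
      by (intro scale add uminus square mult) simp
    also have "(p + q) ^ 2 + - ((p + - q) ^ 2) = poly_const 4 * (p * q)"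
      by (simp add: algebra_simps power2_eq_square)
    finally show ?case
      by (simp flip: mult.assoc poly_const_mult del: poly_const_numeral)
  qed
  then show "\<exists>c. poly_const c - a \<in> Q"
    by (auto simp: P_def)
qed

theorem putinar:
  assumes "archimedean (quadratic_module m g)"
    and "\<forall>x\<in>nonneg_set m g. poly_eval f x > 0"
  shows "f \<in> quadratic_module m g"
proof -
  interpret arch_qmodule "quadratic_module m g"
    by (rule qmodule.arch_qmoduleI[OF qmodule_quadratic_module assms(1)])
  show ?thesis
  proof (rule positivstellensatz)
    fix x assume "\<And>p. p \<in> quadratic_module m g \<Longrightarrow> poly_eval p x \<ge> 0"
    then have "x \<in> nonneg_set m g"
      using generator_mem_quadratic_module unfolding nonneg_set_def by blast
    with assms(2) show "poly_eval f x > 0"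
      by blast
  qed
qed

section \<open>Sign symmetries\<close>

definition keys_filter :: "('a \<Rightarrow> bool) \<Rightarrow> ('a \<Rightarrow>\<^sub>0 'b::comm_monoid_add) \<Rightarrow> ('a \<Rightarrow>\<^sub>0 'b)" where
  "keys_filter P p = (\<Sum>\<alpha>\<in>{\<alpha>\<in>Poly_Mapping.keys p. P \<alpha>}. Poly_Mapping.single \<alpha> (Poly_Mapping.lookup p \<alpha>))"

lemma lookup_keys_filter:
  "Poly_Mapping.lookup (keys_filter P p) \<alpha> = (if P \<alpha> then Poly_Mapping.lookup p \<alpha> else 0)"
  by (auto simp: keys_filter_def lookup_sum lookup_single when_def sum.delta
      not_in_keys_iff_lookup_eq_zero)

lemma keys_keys_filter: "Poly_Mapping.keys (keys_filter P p) = {\<alpha>\<in>Poly_Mapping.keys p. P \<alpha>}"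
  by (auto simp: in_keys_iff lookup_keys_filter split: if_splits)

lemma keys_filter_add: "keys_filter P (p + q) = keys_filter P p + keys_filter P q"
  by (rule poly_mapping_eqI) (simp add: lookup_keys_filter lookup_add)

lemma keys_filter_zero: "keys_filter P 0 = 0"
  by (rule poly_mapping_eqI) (simp add: lookup_keys_filter)

lemma keys_filter_sum: "keys_filter P (sum h S) = (\<Sum>x\<in>S. keys_filter P (h x))"
  by (induction S rule: infinite_finite_induct) (simp_all add: keys_filter_add keys_filter_zero)

lemma keys_filter_id: "(\<And>\<alpha>. \<alpha> \<in> Poly_Mapping.keys p \<Longrightarrow> P \<alpha>) \<Longrightarrow> keys_filter P p = p"
  by (rule poly_mapping_eqI) (auto simp: lookup_keys_filter in_keys_iff)

lemma keys_filter_eq_0: "(\<And>\<alpha>. \<alpha> \<in> Poly_Mapping.keys p \<Longrightarrow> \<not> P \<alpha>) \<Longrightarrow> keys_filter P p = 0"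
  by (rule poly_mapping_eqI) (auto simp: lookup_keys_filter in_keys_iff)

lemma keys_filter_split: "keys_filter P p + keys_filter (\<lambda>\<alpha>. \<not> P \<alpha>) p = p"
  by (rule poly_mapping_eqI) (simp add: lookup_keys_filter lookup_add)

text \<open>This says that the monomial with exponent \<alpha> is fixed by the substitution x_i ->
  (-1)^(r_i) x_i. Filtering by it averages a polynomial with its image under that
  substitution.\<close>

definition sign_even :: "nat^('n::finite) \<Rightarrow> nat^'n \<Rightarrow> bool" where
  "sign_even r \<alpha> \<longleftrightarrow> even (\<Sum>i\<in>UNIV. r $ i * \<alpha> $ i)"

lemma sign_even_add: "sign_even r (\<alpha> + \<beta>) \<longleftrightarrow> (sign_even r \<alpha> \<longleftrightarrow> sign_even r \<beta>)"
  by (simp add: sign_even_def distrib_left sum.distrib)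

text \<open>Multiplication by an invariant polynomial preserves the parity of each monomial, so the
  projection onto the invariant part is linear over invariant polynomials.\<close>

lemma keys_filter_sign_even_mult:
  assumes "\<And>\<alpha>. \<alpha> \<in> Poly_Mapping.keys q \<Longrightarrow> sign_even r \<alpha>"
  shows "keys_filter (sign_even r) (p * q) = keys_filter (sign_even r) p * q"
proof -
  let ?p0 = "keys_filter (sign_even r) p" and ?p1 = "keys_filter (\<lambda>\<alpha>. \<not> sign_even r \<alpha>) p"
  have "keys_filter (sign_even r) (?p0 * q) = ?p0 * q"
    by (rule keys_filter_id)
      (use keys_mult[of ?p0 q] assms in \<open>auto simp: keys_keys_filter sign_even_add\<close>)
  moreover have "keys_filter (sign_even r) (?p1 * q) = 0"
    by (rule keys_filter_eq_0)
      (use keys_mult[of ?p1 q] assms in \<open>auto simp: keys_keys_filter sign_even_add\<close>)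
  moreover have "p * q = ?p0 * q + ?p1 * q"
    by (simp add: keys_filter_split flip: distrib_right)
  ultimately show ?thesis
    by (simp add: keys_filter_add)
qed

lemma keys_filter_sign_even_square:
  fixes p :: "('n::finite) real_mpoly"
  shows "keys_filter (sign_even r) (p ^ 2)
    = keys_filter (sign_even r) p ^ 2 + keys_filter (\<lambda>\<alpha>. \<not> sign_even r \<alpha>) p ^ 2"
proof -
  let ?p0 = "keys_filter (sign_even r) p" and ?p1 = "keys_filter (\<lambda>\<alpha>. \<not> sign_even r \<alpha>) p"
  \<comment> \<open>The squares of both parts are invariant, while the cross term is anti-invariant
    and is deleted. It is written as a sum so that additivity of the filter applies.\<close>
  have p: "p ^ 2 = ?p0 ^ 2 + ?p1 ^ 2 + (?p0 * ?p1 + ?p0 * ?p1)"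
    by (subst keys_filter_split[of "sign_even r" p, symmetric])
      (simp add: power2_eq_square algebra_simps)
  have "keys_filter (sign_even r) (?p0 ^ 2) = ?p0 ^ 2"
    by (rule keys_filter_id)
      (use keys_mult[of ?p0 ?p0] in \<open>auto simp: keys_keys_filter sign_even_add power2_eq_square\<close>)
  moreover have "keys_filter (sign_even r) (?p1 ^ 2) = ?p1 ^ 2"
    by (rule keys_filter_id)
      (use keys_mult[of ?p1 ?p1] in \<open>auto simp: keys_keys_filter sign_even_add power2_eq_square\<close>)
  moreover have "keys_filter (sign_even r) (?p0 * ?p1) = 0"
    by (rule keys_filter_eq_0)
      (use keys_mult[of ?p0 ?p1] in \<open>auto simp: keys_keys_filter sign_even_add\<close>)
  ultimately show ?thesis
    by (subst p) (simp only: keys_filter_add, simp)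
qed

lemma is_sos_keys_filter_sign_even: "is_sos s \<Longrightarrow> is_sos (keys_filter (sign_even r) s)"
  by (induction s rule: is_sos_induct)
    (simp_all add: keys_filter_zero keys_filter_add keys_filter_sign_even_square
      is_sos_0 is_sos_add is_sos_square)

text \<open>The symmetries are imposed one at a time. Filtering only deletes monomials from the
  multipliers, so the parity conditions already achieved survive.\<close>

lemma quadratic_module_sign_even:
  assumes "finite S"
    and f: "\<And>r \<alpha>. r \<in> S \<Longrightarrow> \<alpha> \<in> Poly_Mapping.keys f \<Longrightarrow> sign_even r \<alpha>"
    and g: "\<And>r j \<alpha>. r \<in> S \<Longrightarrow> j \<in> {1..m} \<Longrightarrow> \<alpha> \<in> Poly_Mapping.keys (g j) \<Longrightarrow> sign_even r \<alpha>"
    and mem: "f \<in> quadratic_module m g"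
  shows "\<exists>s. f = s 0 + (\<Sum>j=1..m. s j * g j) \<and>
    (\<forall>j\<in>{0..m}. is_sos (s j) \<and> (\<forall>\<alpha>\<in>Poly_Mapping.keys (s j). \<forall>r\<in>S. sign_even r \<alpha>))"
  using assms(1) f g
proof (induction S rule: finite_induct)
  case empty
  then show ?case
    using mem by (simp add: quadratic_module_def)
next
  case (insert r S)
  then obtain s where s: "f = s 0 + (\<Sum>j=1..m. s j * g j)"
    "\<forall>j\<in>{0..m}. is_sos (s j) \<and> (\<forall>\<alpha>\<in>Poly_Mapping.keys (s j). \<forall>r\<in>S. sign_even r \<alpha>)"
    by auto
  let ?F = "keys_filter (sign_even r)"
  have "f = ?F f"
    using insert.prems by (simp add: keys_filter_id)
  also have "\<dots> = ?F (s 0) + (\<Sum>j=1..m. ?F (s j * g j))"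
    by (subst s(1)) (simp only: keys_filter_add keys_filter_sum)
  also have "(\<Sum>j=1..m. ?F (s j * g j)) = (\<Sum>j=1..m. ?F (s j) * g j)"
    using insert.prems by (intro sum.cong keys_filter_sign_even_mult) auto
  finally have "f = ?F (s 0) + (\<Sum>j=1..m. ?F (s j) * g j)" .
  with s(2) show ?case
    by (intro exI[of _ "\<lambda>j. ?F (s j)"])
      (auto simp: keys_keys_filter is_sos_keys_filter_sign_even)
qed

theorem theorem6p10:
  fixes f :: "('n::finite) real_mpoly"
    and g :: "nat \<Rightarrow> 'n real_mpoly"
    and m :: nat
    and A :: "(nat^'n) set"
    and R :: "nat^('k::finite)^'n"
  assumes "archimedean (quadratic_module m g)"
    and "\<forall>x\<in>nonneg_set m g. poly_eval f x > 0"
    and "A = Poly_Mapping.keys f \<union> (\<Union>j\<in>{1..m}. Poly_Mapping.keys (g j))"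
    and "columns R = sign_symmetries A"
  shows "\<exists>s :: nat \<Rightarrow> 'n real_mpoly.
           f = s 0 + (\<Sum>j=1..m. s j * g j) \<and>
           (\<forall>j\<in>{0..m}. is_sos (s j) \<and>
              (\<forall>\<alpha>\<in>Poly_Mapping.keys (s j). \<forall>c. [(transpose R *v \<alpha>) $ c = 0] (mod 2)))"
proof -
  let ?S = "sign_symmetries A"
  have even: "sign_even r \<alpha>" if "r \<in> ?S" "\<alpha> \<in> A" for r \<alpha>
    using that by (simp add: sign_symmetries_def sign_even_def cong_0_iff)
  \<comment> \<open>The columns of \<open>R\<close> are indexed by a finite type.\<close>
  have "finite ?S"
    unfolding assms(4)[symmetric] columns_def by (simp add: full_SetCompr_eq)
  then obtain s where s: "f = s 0 + (\<Sum>j=1..m. s j * g j)"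
    "\<forall>j\<in>{0..m}. is_sos (s j) \<and> (\<forall>\<alpha>\<in>Poly_Mapping.keys (s j). \<forall>r\<in>?S. sign_even r \<alpha>)"
    using quadratic_module_sign_even[OF _ _ _ putinar[OF assms(1,2)], of ?S] even assms(3)
    by blast
  have "[(transpose R *v \<alpha>) $ c = 0] (mod 2)" if "\<forall>r\<in>?S. sign_even r \<alpha>" for \<alpha> c
  proof -
    \<comment> \<open>Entry \<open>c\<close> of the product is the pairing of \<alpha> with column
      \<open>c\<close> of \<open>R\<close>, which is a sign-symmetry.\<close>
    have "column c R \<in> ?S"
      unfolding assms(4)[symmetric] columns_def by blast
    with that have "sign_even (column c R) \<alpha>"
      by blast
    then show ?thesis
      by (simp add: sign_even_def column_def transpose_def matrix_vector_mult_def cong_0_iff)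
  qed
  with s show ?thesis
    by blast
qed

end
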